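(* Let $k\in\mathbb{N}$ with $k\ge 1$ and $p\in[1,\infty]$. For $\mathbf{x}=(x_1,\dots,x_k)$ and $\mathbf{y}=(y_1,\dots,y_k)$ in $\mathbb{R}^k$ define $$d_N^p(\mathbf{x},\mathbf{y})=\frac{d^p(\mathbf{x},\mathbf{y})}{\sum_{i=1}^k\max(|x_i|,|y_i|,|x_i-y_i|)},$$ where $$d^p(\mathbf{x},\mathbf{y})=\Big(\big(\sum_{i:\,x_i\ge y_i}(x_i-y_i)\big)^p+\big(\sum_{i:\,x_i<y_i}(y_i-x_i)\big)^p\Big)^{1/p}$$ (for $p=\infty$, $d^\infty$ is the maximum of the two sums), with the convention $0/0:=0$. Then $(\mathbb{R}^k,d_N^p)$ is a metric space. In addition, $d_N^p$ takes values in $[0,1]$.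
   Context: Empty sums are $0$. A metric $d$ is a real-valued function that is nonnegative, symmetric, satisfies $d(a,b)=0\iff a=b$, and satisfies the triangle inequality. *)

theory Defs
  imports "HOL-Analysis.Analysis"
begin

definition dp :: "ereal \<Rightarrow> real ^ 'k \<Rightarrow> real ^ 'k \<Rightarrow> real" where
  "dp p x y =
    (let a = (\<Sum>i | x $ i \<ge> y $ i. x $ i - y $ i);
         b = (\<Sum>i | x $ i < y $ i. y $ i - x $ i)
     in if p = \<infinity> then max a b
        else (a powr real_of_ereal p + b powr real_of_ereal p) powr (1 / real_of_ereal p))"

text \<open>The convention \<open>0/0 = 0\<close> is the one of division on \<^typ>\<open>real\<close>. The denominator vanishes
  only for \<open>x = y = 0\<close>, so no other division by zero occurs.\<close>

definition dNp :: "ereal \<Rightarrow> real ^ 'k \<Rightarrow> real ^ 'k \<Rightarrow> real" where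
  "dNp p x y =
    dp p x y / (\<Sum>i\<in>UNIV. max \<bar>x $ i\<bar> (max \<bar>y $ i\<bar> \<bar>x $ i - y $ i\<bar>))"

end

theory Submission
  imports Defs
begin

text \<open>Write \<open>N(a,b)\<close> for the \<open>\<ell>\<^sup>p\<close> norm on the quadrant \<open>a, b \<ge> 0\<close> and \<open>\<rho>\<close> for the \<open>\<ell>\<^sup>1\<close> distance.
  The denominator of the metric is half of \<open>\<parallel>x\<parallel> + \<parallel>z\<parallel> + \<rho>(x,z)\<close> (with \<open>\<ell>\<^sup>1\<close> norms), so for \<open>p = 1\<close>
  the metric is the Steinhaus transform of \<open>\<rho>\<close>. For general \<open>p\<close>, passing through a third point \<open>y\<close> increases
  the positive and the negative part of \<open>x - z\<close> by the same amount \<open>t\<close>. The quotient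
  \<open>N(a + t, b + t) / (c + a + b + 2 t)\<close> is nondecreasing in \<open>t\<close> provided \<open>c \<ge> \<bar>a - b\<bar>\<close>,
  and \<open>c = \<parallel>x\<parallel> + \<parallel>z\<parallel>\<close> satisfies this, because \<open>a - b\<close> is the sum of the coordinates of \<open>x - z\<close>.
  Minkowski's inequality for \<open>N\<close> and the triangle inequality for \<open>\<rho>\<close> then finish as in the
  Steinhaus case.\<close>

section \<open>Convexity of powers and the l^p norm on the quadrant\<close>

lemma powr_convex_nonneg:
  fixes u v t q :: real
  assumes "1 \<le> q" "0 \<le> u" "0 \<le> v" "0 \<le> t" "t \<le> 1"
  shows "((1 - t) * u + t * v) powr q \<le> (1 - t) * u powr q + t * v powr q"
proof -
  \<comment> \<open>This settles u = 0 or v = 0; otherwise both are positive and convexity of the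
    power applies.\<close>
  have scale: "(s * w) powr q \<le> s * w powr q" if "0 \<le> s" "s \<le> 1" for s w :: real
  proof -
    have "s powr q \<le> s"
    proof (cases "s = 0")
      case False
      then have "s powr q \<le> s powr 1" using that assms(1) by (intro powr_mono') auto
      then show ?thesis using that False by simp
    qed simp
    then show ?thesis by (simp add: powr_mult mult_right_mono)
  qed
  show ?thesis
  proof (cases "u = 0 \<or> v = 0")
    case True
    then show ?thesis using scale[of t v] scale[of "1 - t" u] assms by auto
  next
    case False
    then show ?thesis
      using convex_onD[OF powr_convex[OF assms(1)], of t u v] assms by simp
  qed
qed

definition pnorm :: "ereal \<Rightarrow> real \<Rightarrow> real \<Rightarrow> real" where
  "pnorm p a b =
    (if p = \<infinity> then max a b
     else (a powr real_of_ereal p + b powr real_of_ereal p) powr (1 / real_of_ereal p))"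

lemma ereal_ge_1_cases:
  assumes "1 \<le> (p::ereal)"
  obtains "p = \<infinity>" | q where "p = ereal q" "1 \<le> q"
  using assms by (cases p) (auto simp: one_ereal_def)

lemma pnorm_commute: "pnorm p a b = pnorm p b a"
  by (simp add: pnorm_def add.commute max.commute)

lemma pnorm_nonneg: "0 \<le> a \<Longrightarrow> 0 \<le> pnorm p a b"
  by (simp add: pnorm_def le_max_iff_disj)

lemma pnorm_mono:
  assumes "1 \<le> p" "0 \<le> a" "a \<le> a'" "0 \<le> b" "b \<le> b'"
  shows "pnorm p a b \<le> pnorm p a' b'"
  using assms(1)
proof (cases rule: ereal_ge_1_cases)
  case 1
  then show ?thesis using assms by (auto simp: pnorm_def)
next
  case (2 q)
  then show ?thesis using assms
    by (auto simp: pnorm_def intro!: powr_mono2 add_mono)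
qed

lemma pnorm_scale:
  assumes "1 \<le> p" "0 \<le> c"
  shows "pnorm p (c * a) (c * b) = c * pnorm p a b"
  using assms(1)
proof (cases rule: ereal_ge_1_cases)
  case 1
  then show ?thesis using assms by (simp add: pnorm_def max_mult_distrib_left)
next
  case (2 q)
  have "(c * a) powr q + (c * b) powr q = c powr q * (a powr q + b powr q)"
    by (simp add: powr_mult distrib_left)
  then show ?thesis using assms 2
    by (simp add: pnorm_def powr_mult powr_powr)
qed

lemma pnorm_0_right:
  assumes "1 \<le> p" "0 \<le> a"
  shows "pnorm p a 0 = a"
  using assms(1)
  by (cases rule: ereal_ge_1_cases) (use assms in \<open>auto simp: pnorm_def powr_powr\<close>)

lemma pnorm_eq_0_iff:
  assumes "1 \<le> p" "0 \<le> a" "0 \<le> b"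
  shows "pnorm p a b = 0 \<longleftrightarrow> a = 0 \<and> b = 0"
  using assms(1)
proof (cases rule: ereal_ge_1_cases)
  case 1
  then show ?thesis using assms by (auto simp: pnorm_def max_def)
next
  case (2 q)
  then show ?thesis using assms by (auto simp: pnorm_def add_nonneg_eq_0_iff)
qed

text \<open>For finite p, normalise: with M and N the two norms, (a + c) / (M + N) is the convex
  combination of a / M and c / N with weights M / (M + N) and N / (M + N), and likewise for b and d.
  Apply convexity of the q-th power to each coordinate and add.\<close>

lemma pnorm_triangle:
  assumes p: "1 \<le> p" and nn: "0 \<le> a" "0 \<le> b" "0 \<le> c" "0 \<le> d"
  shows "pnorm p (a + c) (b + d) \<le> pnorm p a b + pnorm p c d"
proof (cases "pnorm p a b = 0 \<or> pnorm p c d = 0")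
  case True
  then show ?thesis using assms by (auto simp: pnorm_eq_0_iff pnorm_nonneg)
next
  case False
  show ?thesis using p
  proof (cases rule: ereal_ge_1_cases)
    case 1
    then show ?thesis by (auto simp: pnorm_def)
  next
    case (2 q)
    define M where "M = pnorm p a b"
    define N where "N = pnorm p c d"
    define t where "t = N / (M + N)"
    have pos: "0 < M" "0 < N"
      using False nn pnorm_nonneg[of a p b] pnorm_nonneg[of c p d] by (auto simp: M_def N_def)
    have t: "0 \<le> t" "t \<le> 1" "1 - t = M / (M + N)"
      using pos by (auto simp: t_def field_simps)
    have Mq: "a powr q + b powr q = M powr q" and Nq: "c powr q + d powr q = N powr q"
      using 2 by (auto simp: M_def N_def pnorm_def powr_powr)
    have cvx: "(u + v) powr q
        \<le> (M + N) powr q * ((1 - t) * (u powr q / M powr q) + t * (v powr q / N powr q))"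
      if "0 \<le> u" "0 \<le> v" for u v
    proof -
      have "u + v = (M + N) * ((1 - t) * (u / M) + t * (v / N))"
        unfolding t(3) using pos by (simp add: t_def distrib_left)
      then have "(u + v) powr q = (M + N) powr q * ((1 - t) * (u / M) + t * (v / N)) powr q"
        by (metis powr_mult)
      also have "\<dots> \<le> (M + N) powr q * ((1 - t) * (u / M) powr q + t * (v / N) powr q)"
        using that pos t 2 by (intro mult_left_mono powr_convex_nonneg) auto
      finally show ?thesis by (simp add: powr_divide)
    qed
    have "(a + c) powr q + (b + d) powr q
        \<le> (M + N) powr q * ((1 - t) * ((a powr q + b powr q) / M powr q)
            + t * ((c powr q + d powr q) / N powr q))"
      using cvx[of a c] cvx[of b d] nn by (simp add: algebra_simps add_divide_distrib)
    also have "\<dots> = (M + N) powr q"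
      using pos by (simp add: Mq Nq)
    finally have "((a + c) powr q + (b + d) powr q) powr (1 / q) \<le> ((M + N) powr q) powr (1 / q)"
      using 2 by (intro powr_mono2) auto
    also have "\<dots> = M + N"
      using pos 2 by (simp add: powr_powr)
    finally show ?thesis
      using 2 by (simp add: pnorm_def M_def N_def)
  qed
qed

lemma pnorm_le_add:
  assumes "1 \<le> p" "0 \<le> a" "0 \<le> b"
  shows "pnorm p a b \<le> a + b"
  using pnorm_triangle[of p a 0 0 b] assms pnorm_commute[of p 0 b]
  by (simp add: pnorm_0_right)

text \<open>Let s be the left denominator. Scaling numerator and denominator by l = (s + 2 t) / s
  keeps the quotient and produces the right denominator. By monotonicity of the norm it then
  suffices that l a \<le> a + t and l b \<le> b + t.\<close>

lemma pnorm_quotient_mono: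
  assumes p: "1 \<le> p" and nn: "0 \<le> a" "0 \<le> b" "0 \<le> t" and c: "\<bar>a - b\<bar> \<le> c"
  shows "pnorm p a b / (c + (a + b)) \<le> pnorm p (a + t) (b + t) / (c + (a + t + (b + t)))"
proof (cases "c + (a + b) = 0")
  case True
  \<comment> \<open>The left side is 0 because division by 0 yields 0.\<close>
  then show ?thesis using nn c pnorm_nonneg[of "a + t" p "b + t"] by simp
next
  case False
  define s where "s = c + (a + b)"
  define l where "l = 1 + 2 * t / s"
  have s: "0 < s" using False nn c by (simp add: s_def)
  then have l: "0 < l" using nn by (simp add: l_def add_pos_nonneg)
  \<comment> \<open>These two bounds say a - b \<le> c and b - a \<le> c.\<close>
  have "2 * a \<le> s" "2 * b \<le> s" using c by (auto simp: s_def)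
  then have "t * (2 * a) \<le> t * s" "t * (2 * b) \<le> t * s"
    using nn by (auto intro!: mult_left_mono)
  then have le: "l * a \<le> a + t" "l * b \<le> b + t"
    using s by (auto simp: l_def field_simps)
  have "l * pnorm p a b \<le> pnorm p (a + t) (b + t)"
    unfolding pnorm_scale[OF p less_imp_le[OF l], symmetric]
    using p l nn le by (intro pnorm_mono) auto
  moreover have "c + (a + t + (b + t)) = l * s"
    using s by (simp add: l_def s_def field_simps)
  moreover have "pnorm p a b / s = l * pnorm p a b / (l * s)"
    using l by simp
  ultimately show ?thesis
    using s l unfolding s_def[symmetric] by (metis divide_right_mono less_imp_le mult_pos_pos)
qed

section \<open>Positive parts of differences and the l^1 norm\<close>

definition pos_diff :: "real ^ 'k \<Rightarrow> real ^ 'k \<Rightarrow> real" where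
  "pos_diff x y = (\<Sum>i\<in>UNIV. max 0 (x $ i - y $ i))"

definition norm1 :: "real ^ 'k \<Rightarrow> real" where
  "norm1 x = (\<Sum>i\<in>UNIV. \<bar>x $ i\<bar>)"

lemma pos_diff_nonneg: "0 \<le> pos_diff x y"
  by (simp add: pos_diff_def sum_nonneg)

lemma pos_diff_triangle: "pos_diff x z \<le> pos_diff x y + pos_diff y z"
  unfolding pos_diff_def sum.distrib[symmetric] by (intro sum_mono) auto

text \<open>Coordinatewise, max(0, r) - max(0, -r) = r. Hence this difference is additive along x,
  y, z.\<close>

lemma pos_diff_skew: "pos_diff x y - pos_diff y x = (\<Sum>i\<in>UNIV. x $ i) - (\<Sum>i\<in>UNIV. y $ i)"
  unfolding pos_diff_def sum_subtractf[symmetric] by (intro sum.cong) auto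

lemma pos_diff_add: "pos_diff x y + pos_diff y x = norm1 (x - y)"
  unfolding pos_diff_def norm1_def sum.distrib[symmetric] by (intro sum.cong) auto

lemma pos_diff_eq_0_iff: "pos_diff x y = 0 \<and> pos_diff y x = 0 \<longleftrightarrow> x = y"
proof -
  have "pos_diff x y = 0 \<longleftrightarrow> (\<forall>i. x $ i \<le> y $ i)" for x y :: "real ^ 'a"
    by (simp add: pos_diff_def sum_nonneg_eq_0_iff flip: max.absorb_iff1)
  then show ?thesis by (auto simp: vec_eq_iff intro: antisym)
qed

lemma norm1_nonneg: "0 \<le> norm1 x"
  by (simp add: norm1_def sum_nonneg)

lemma norm1_triangle: "norm1 (x + y) \<le> norm1 x + norm1 y"
  unfolding norm1_def sum.distrib[symmetric] by (intro sum_mono) auto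

lemma norm1_minus: "norm1 (- x) = norm1 x"
  by (simp add: norm1_def)

lemma norm1_diff_le: "norm1 (x - y) \<le> norm1 x + norm1 y"
  using norm1_triangle[of x "- y"] by (simp add: norm1_minus)

lemma abs_pos_diff_skew_le: "\<bar>pos_diff x y - pos_diff y x\<bar> \<le> norm1 x + norm1 y"
  using sum_abs[of "\<lambda>i. x $ i" UNIV] sum_abs[of "\<lambda>i. y $ i" UNIV]
  unfolding pos_diff_skew norm1_def by linarith

section \<open>The metric as a Steinhaus-type quotient\<close>

lemma dp_eq_pnorm: "dp p x y = pnorm p (pos_diff x y) (pos_diff y x)"
proof -
  have "(\<Sum>i | x $ i \<ge> y $ i. x $ i - y $ i) = pos_diff x y"
    unfolding pos_diff_def by (rule sum.mono_neutral_cong_left) auto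
  moreover have "(\<Sum>i | x $ i < y $ i. y $ i - x $ i) = pos_diff y x"
    unfolding pos_diff_def by (rule sum.mono_neutral_cong_left) auto
  ultimately show ?thesis by (simp add: dp_def pnorm_def Let_def)
qed

text \<open>The largest of |r|, |s|, |r - s| is always the sum of the other two: |r - s| for
  opposite signs, the larger of |r| and |s| otherwise. So the maximum is half of the total.\<close>

lemma dNp_eq:
  "dNp p x y = 2 * (pnorm p (pos_diff x y) (pos_diff y x)
    / (norm1 x + norm1 y + (pos_diff x y + pos_diff y x)))"
proof -
  have D: "2 * (\<Sum>i\<in>UNIV. max \<bar>x $ i\<bar> (max \<bar>y $ i\<bar> \<bar>x $ i - y $ i\<bar>))
      = norm1 x + norm1 y + (pos_diff x y + pos_diff y x)"
    unfolding pos_diff_add norm1_def sum.distrib[symmetric] sum_distrib_left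
    by (intro sum.cong) (auto simp: max_def abs_if)
  then show ?thesis by (simp add: dNp_def dp_eq_pnorm flip: D)
qed

lemma dNp_triangle:
  assumes p: "1 \<le> p"
  shows "dNp p x z \<le> dNp p x y + dNp p y z"
proof -
  define a b where "a = pos_diff x z" and "b = pos_diff z x"
  define a1 b1 where "a1 = pos_diff x y" and "b1 = pos_diff y x"
  define a2 b2 where "a2 = pos_diff y z" and "b2 = pos_diff z y"
  define t where "t = a1 + a2 - a"
  note defs = a_def b_def a1_def b1_def a2_def b2_def
  have nn: "0 \<le> a" "0 \<le> b" "0 \<le> a1" "0 \<le> b1" "0 \<le> a2" "0 \<le> b2"
    by (simp_all add: defs pos_diff_nonneg)
  \<comment> \<open>The negative parts have the same excess t, since a - b = (a1 - b1) + (a2 -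
    b2).\<close>
  have t: "0 \<le> t" "a + t = a1 + a2" "b + t = b1 + b2"
    using pos_diff_triangle[of x z y] pos_diff_skew[of x z] pos_diff_skew[of x y]
      pos_diff_skew[of y z]
    by (auto simp: t_def defs)
  \<comment> \<open>The denominator for x, z enlarged by 2 t. It dominates the other two: for x, y
    bound the norm of y by that of z plus a2 + b2, for y, z by that of x plus a1 + b1.\<close>
  define D where "D = norm1 x + norm1 z + (a1 + a2 + (b1 + b2))"
  have D1: "norm1 x + norm1 y + (a1 + b1) \<le> D"
    using norm1_triangle[of z "y - z"] pos_diff_add[of y z] by (simp add: D_def defs)
  have D2: "norm1 y + norm1 z + (a2 + b2) \<le> D"
    using norm1_triangle[of x "y - x"] pos_diff_add[of y x] by (simp add: D_def defs)
  have weaken: "pnorm p u v / D \<le> pnorm p u v / (n + (u + v))"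
    if "0 \<le> u" "0 \<le> v" "0 \<le> n" "n + (u + v) \<le> D" for u v n
  proof (cases "n + (u + v) = 0")
    case True
    \<comment> \<open>The smaller denominator may be 0, but then the numerator vanishes too.\<close>
    then have "u = 0" "v = 0" using that by auto
    then show ?thesis using p by (simp add: pnorm_0_right)
  next
    case False
    then show ?thesis using that by (intro divide_left_mono mult_pos_pos pnorm_nonneg) auto
  qed
  have "pnorm p a b / (norm1 x + norm1 z + (a + b)) \<le> pnorm p (a1 + a2) (b1 + b2) / D"
    using pnorm_quotient_mono[OF p nn(1,2) t(1), of "norm1 x + norm1 z"]
      abs_pos_diff_skew_le[of x z]
    by (simp add: t(2,3) D_def) (simp add: a_def b_def)
  also have "\<dots> \<le> (pnorm p a1 b1 + pnorm p a2 b2) / D"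
    using pnorm_triangle[OF p, of a1 b1 a2 b2] nn norm1_nonneg[of x] norm1_nonneg[of z]
    by (intro divide_right_mono) (auto simp: D_def)
  also have "\<dots> = pnorm p a1 b1 / D + pnorm p a2 b2 / D"
    by (rule add_divide_distrib)
  also have "\<dots> \<le> pnorm p a1 b1 / (norm1 x + norm1 y + (a1 + b1))
      + pnorm p a2 b2 / (norm1 y + norm1 z + (a2 + b2))"
    using nn D1 D2 by (intro add_mono weaken) (auto simp: norm1_nonneg)
  finally show ?thesis by (simp add: dNp_eq defs)
qed

theorem theorem3p4:
  fixes p :: ereal
  assumes "1 \<le> p"
  shows "Metric_space (UNIV :: (real ^ 'k) set) (dNp p)
    \<and> (\<forall>x y :: real ^ 'k. dNp p x y \<in> {0..1})"
proof -
  have nonneg: "0 \<le> dNp p x y" for x y :: "real ^ 'k"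
    by (simp add: dNp_eq pnorm_nonneg pos_diff_nonneg norm1_nonneg)
  have le_1: "dNp p x y \<le> 1" for x y :: "real ^ 'k"
  proof -
    \<comment> \<open>The norm is at most the l^1 distance of x and y, which is itself at most the
      sum of their norms.\<close>
    have "2 * pnorm p (pos_diff x y) (pos_diff y x)
        \<le> norm1 x + norm1 y + (pos_diff x y + pos_diff y x)"
      using pnorm_le_add[OF assms pos_diff_nonneg pos_diff_nonneg, of x y y x]
        norm1_diff_le[of x y] pos_diff_add[of x y] by linarith
    then show ?thesis
      using norm1_nonneg[of x] norm1_nonneg[of y] pos_diff_nonneg[of x y] pos_diff_nonneg[of y x]
      by (auto simp: dNp_eq divide_le_eq_1)
  qed
  have zero: "dNp p x y = 0 \<longleftrightarrow> x = y" for x y :: "real ^ 'k"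
  proof -
    \<comment> \<open>A quotient 0/0 thus arises only for x = y, so it identifies no distinct
      points.\<close>
    have "pos_diff x y = 0 \<and> pos_diff y x = 0"
      if "norm1 x + norm1 y + (pos_diff x y + pos_diff y x) = 0"
      using that norm1_nonneg[of x] norm1_nonneg[of y] pos_diff_nonneg[of x y]
        pos_diff_nonneg[of y x] by linarith
    then show ?thesis
      unfolding dNp_eq pos_diff_eq_0_iff[symmetric]
      using pnorm_eq_0_iff[OF assms pos_diff_nonneg pos_diff_nonneg, of x y y x]
      by (metis divide_eq_0_iff mult_eq_0_iff zero_neq_numeral)
  qed
  have commute: "dNp p x y = dNp p y x" for x y :: "real ^ 'k"
    by (simp add: dNp_eq pnorm_commute[of p "pos_diff x y"] add.commute)
  show ?thesis
    using nonneg le_1 zero commute dNp_triangle[OF assms] by (auto intro!: Metric_space.intro)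
qed

end
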